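(* If $B$ is a finite skew left brace such that $\mathrm{Pb}(B)>\frac{65}{128}$, then $B$ is nilpotent.
   Context: A skew left brace is a set $B$ with two group structures $(B,+)$ and $(B,\circ)$ (neither assumed abelian) such that $a\circ(b+c)=(a\circ b)-a+(a\circ c)$ for all $a,b,c\in B$, where $-a$ is the inverse of $a$ in $(B,+)$. The identities of the two groups coincide and are denoted by $1$. Put $a*b:=-a+(a\circ b)-b$ and $[a,b]^+:=a+b-a-b$. For a finite skew left brace $B$, the commuting probability is $$\mathrm{Pb}(B):=\frac{1}{|B|^2}\,\bigl|\{(a,b)\in B\times B \mid a*b=b*a=[a,b]^+=1\}\bigr|.$$ The annihilator of $B$ is $\mathrm{Ann}(B):=\{a\in B\mid a+b=b+a=a\circ b=b\circ a \text{ for all } b\in B\}$, which is an ideal of $B$. Set $\mathrm{Ann}_1(B)=\mathrm{Ann}(B)$ and, for $n\geq 2$, define the ideal $\mathrm{Ann}_n(B)$ by $\mathrm{Ann}_n(B)/\mathrm{Ann}_{n-1}(B)=\mathrm{Ann}\bigl(B/\mathrm{Ann}_{n-1}(B)\bigr)$; equivalently $\mathrm{Ann}_n(B)=\{a\in B\mid a*b,\ b*a,\ [a,b]^+\in\mathrm{Ann}_{n-1}(B)\text{ for all } b\in B\}$. The skew brace $B$ is called nilpotent if $\mathrm{Ann}_n(B)=B$ for some integer $n$. *)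

theory Defs
  imports "HOL-Algebra.Algebra"
begin

(* The record type 'a ring serves only as a signature carrying two operations:
   \<oplus> is the group operation + of the brace (not assumed commutative) and
   \<otimes> is its group operation \<circ>.  No ring axioms are assumed. *)
locale skew_left_brace =
  fixes B (structure)
  assumes add_group: "group (add_monoid B)"
    and circ_group: "group B"
    and brace_eq: "\<lbrakk>a \<in> carrier B; b \<in> carrier B; c \<in> carrier B\<rbrakk>
      \<Longrightarrow> a \<otimes> (b \<oplus> c) = ((a \<otimes> b) \<ominus> a) \<oplus> (a \<otimes> c)"

(* The two identities coincide, so the paper's 1 may be written \<zero> or \<one>. *)
lemma (in skew_left_brace) one_eq_zero: "\<one> = \<zero>"
proof -
  interpret A: group "add_monoid B" by (rule add_group)
  interpret M: group B by (rule circ_group)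
  have z: "\<zero> \<in> carrier B" using A.one_closed by simp
  have m: "\<ominus> \<one> \<in> carrier B" using A.inv_closed[of \<one>] by (simp add: a_inv_def)
  have l: "\<zero> \<oplus> x = x" "x \<oplus> \<zero> = x" if "x \<in> carrier B" for x
    using A.l_one[of x] A.r_one[of x] that by simp_all
  have "\<one> \<otimes> (\<zero> \<oplus> \<zero>) = ((\<one> \<otimes> \<zero>) \<ominus> \<one>) \<oplus> (\<one> \<otimes> \<zero>)"
    using z by (intro brace_eq) auto
  hence "\<zero> = \<ominus> \<one>"
    using z m by (simp add: a_minus_def l)
  thus ?thesis
    using A.inv_inv[of \<one>] A.inv_one by (simp add: a_inv_def)
qed

definition brace_star :: "('a, 'm) ring_scheme \<Rightarrow> 'a \<Rightarrow> 'a \<Rightarrow> 'a" where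
  "brace_star B a b = (\<ominus>\<^bsub>B\<^esub> a \<oplus>\<^bsub>B\<^esub> (a \<otimes>\<^bsub>B\<^esub> b)) \<ominus>\<^bsub>B\<^esub> b"

definition add_commutator :: "('a, 'm) ring_scheme \<Rightarrow> 'a \<Rightarrow> 'a \<Rightarrow> 'a" where
  "add_commutator B a b = ((a \<oplus>\<^bsub>B\<^esub> b) \<ominus>\<^bsub>B\<^esub> a) \<ominus>\<^bsub>B\<^esub> b"

definition commuting_probability :: "('a, 'm) ring_scheme \<Rightarrow> real" where
  "commuting_probability B =
    1 / real (card (carrier B)) ^ 2 *
    real (card {(a, b) \<in> carrier B \<times> carrier B.
      brace_star B a b = \<zero>\<^bsub>B\<^esub> \<and> brace_star B b a = \<zero>\<^bsub>B\<^esub> \<and> add_commutator B a b = \<zero>\<^bsub>B\<^esub>})"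

definition annihilator :: "('a, 'm) ring_scheme \<Rightarrow> 'a set" where
  "annihilator B = {a \<in> carrier B. \<forall>b \<in> carrier B.
     a \<oplus>\<^bsub>B\<^esub> b = b \<oplus>\<^bsub>B\<^esub> a \<and> b \<oplus>\<^bsub>B\<^esub> a = a \<otimes>\<^bsub>B\<^esub> b \<and> a \<otimes>\<^bsub>B\<^esub> b = b \<otimes>\<^bsub>B\<^esub> a}"

(* B Quot I is the library's coset construction: its elements are the additive cosets
   I +> a, added by (I +> a) + (I +> b) = I +> (a \<oplus> b), and the product of two cosets is
   the union of all I +> (x \<otimes> y) with x, y in the respective cosets.  For an ideal I of a
   skew brace this union is the single coset I +> (a \<otimes> b), so B Quot I is the quotient
   skew brace.  Ann_n(B) is the preimage of Ann(B / Ann_{n-1}(B)) in B.  The series starts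
   at index 1; the value {\<zero>} at index 0 is a convention that is not used. *)
fun annihilator_series :: "('a, 'm) ring_scheme \<Rightarrow> nat \<Rightarrow> 'a set" where
  "annihilator_series B 0 = {\<zero>\<^bsub>B\<^esub>}"
| "annihilator_series B (Suc 0) = annihilator B"
| "annihilator_series B (Suc (Suc n)) =
     {a \<in> carrier B. annihilator_series B (Suc n) +>\<^bsub>B\<^esub> a
        \<in> annihilator (B Quot annihilator_series B (Suc n))}"

definition nilpotent_brace :: "('a, 'm) ring_scheme \<Rightarrow> bool" where
  "nilpotent_brace B \<longleftrightarrow> (\<exists>n\<ge>1. annihilator_series B n = carrier B)"

end

theory Submission
  imports Defs
begin

text \<open>
  Let \<open>C(a)\<close> be the set of elements that commute with \<open>a\<close> in the sense of the commuting
  probability, so that \<open>b \<in> C(a)\<close> means \<open>a + b = b + a = a \<circ> b = b \<circ> a\<close>. It is a subgroup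
  of \<open>(B,\<circ>)\<close> (\<open>circ_subgroup_brace_centralizer\<close>), hence its size divides \<open>n = |B|\<close>, and
  \<open>C(a) = B\<close> exactly when \<open>a \<in> Ann(B)\<close>. The heart of the proof is that a brace with more than one
  element in which more than half of all pairs commute has a nontrivial annihilator
  (\<open>annihilator_nontrivial\<close>).

  Suppose \<open>Ann(B)\<close> is trivial, and let \<open>T\<close> be the set of all \<open>a\<close> with \<open>|C(a)| = n/2\<close>.
  A nonzero element outside \<open>T\<close> has \<open>|C(a)| \<le> n/3\<close>, so summing \<open>|C(a)|\<close> over \<open>B\<close> leaves at most two
  nonzero elements outside \<open>T\<close>. An element \<open>s\<close> that commutes with all of \<open>T\<close> then has
  \<open>|C(s)| > n/2\<close> (with separate arguments for \<open>n \<le> 4\<close>), so \<open>s = 0\<close>. For \<open>a \<in> T\<close> the subgroup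
  \<open>C(a)\<close> has index two and contains all squares; so squares commute with all of \<open>T\<close> and vanish. This applies to \<open>(B,\<circ>)\<close> first and, once
  \<open>\<circ>\<close> is known to be commutative and \<open>C(a)\<close> therefore an additive subgroup, to \<open>(B,+)\<close> as well: both
  groups are elementary abelian 2-groups.

  For \<open>a \<in> T\<close> the map \<open>b \<mapsto> - a + a \<circ> b\<close> is now an additive involution fixing the hyperplane
  \<open>C(a)\<close>, that is, a transvection: \<open>a \<circ> b = a + b + u\<close> for all \<open>b \<notin> C(a)\<close>, with \<open>u\<close> depending on
  \<open>a\<close> only. Since \<open>a + b + a \<circ> b\<close> is symmetric in \<open>a\<close> and \<open>b\<close>, two elements of \<open>T\<close> share the same
  \<open>u\<close> if they do not commute, or if a third element of \<open>T\<close> commutes with neither of them. For commuting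
  elements such a third one exists: two proper subgroups never cover a group, and multiplying one
  element outside both centralizers by the two given elements produces enough of them to meet \<open>T\<close>.
  So \<open>u\<close> is the same for all of \<open>T\<close>. The involution property gives
  \<open>u \<in> C(a)\<close> for all \<open>a \<in> T\<close>, so \<open>u = 0\<close>. But then \<open>a \<circ> b = a + b\<close> for some \<open>b \<notin> C(a)\<close>, which is
  a contradiction.

  For nilpotency, commuting pairs of \<open>B\<close> map to commuting pairs of a quotient \<open>B/I\<close>, so the
  proportion of commuting pairs does not drop in quotients. As long as \<open>Ann\<^sub>n(B) \<noteq> B\<close>, the previous
  result applies to \<open>B/Ann\<^sub>n(B)\<close> and shows that \<open>Ann\<^sub>n\<^sub>+\<^sub>1(B)\<close> is strictly larger
  (\<open>annihilator_series_grows\<close>); since \<open>B\<close> is finite, the series reaches \<open>B\<close>.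
\<close>

section \<open>Subgroups of small index\<close>

text \<open>
  The coset \<open>inv x <# H\<close> is disjoint from \<open>H\<close> and of the same size, so for index two it is the whole
  complement of \<open>H\<close> and contains \<open>y\<close>. Applied to both group structures of a brace, this is what
  forces squares into every centralizer of index two.
\<close>

lemma (in group) mult_mem_index_two:
  assumes "finite (carrier G)" and H: "subgroup H G" and two: "2 * card H = card (carrier G)"
    and x: "x \<in> carrier G" "x \<notin> H" and y: "y \<in> carrier G" "y \<notin> H"
  shows "x \<otimes> y \<in> H"
proof -
  interpret H: subgroup H G by (rule H)
  let ?K = "(\<lambda>h. inv x \<otimes> h) ` H"
  have fin: "finite H" using H.subset assms(1) by (rule finite_subset)
  have cK: "card ?K = card H"
    using x(1) H.subset by (intro card_image inj_onI) (metis inv_closed l_cancel subsetD)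
  have disj: "H \<inter> ?K = {}"
  proof (rule equals0I)
    fix z assume "z \<in> H \<inter> ?K"
    then obtain h where h: "h \<in> H" "inv x \<otimes> h \<in> H" by (auto simp: image_iff)
    hence "inv x \<otimes> h \<otimes> inv h \<in> H" by auto
    moreover have "inv x \<otimes> h \<otimes> inv h = inv x"
      using h x(1) H.subset by (simp add: m_assoc subsetD)
    ultimately have "inv (inv x) \<in> H" by (metis H.m_inv_closed)
    with x show False by simp
  qed
  have "H \<union> ?K = carrier G"
  proof (rule card_subset_eq)
    show "H \<union> ?K \<subseteq> carrier G" using x(1) H.subset by (auto simp: image_iff)
    show "card (H \<union> ?K) = card (carrier G)"
      using disj fin cK two by (subst card_Un_disjoint) (auto simp: image_iff)
  qed (rule assms(1))
  with y obtain h where "h \<in> H" "y = inv x \<otimes> h" by (auto simp: image_iff)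
  thus ?thesis using x(1) H.subset by (simp add: m_assoc[symmetric] subsetD)
qed

lemma (in group) square_mem_index_two:
  assumes "finite (carrier G)" "subgroup H G" "2 * card H = card (carrier G)" "x \<in> carrier G"
  shows "x \<otimes> x \<in> H"
  using mult_mem_index_two[OF assms(1-3), of x x] assms(2,4) subgroup.m_closed[OF assms(2)] by blast

text \<open>
  Orders of elements divide three. This serves the sporadic case of a brace with three elements.
\<close>

lemma (in group) involution_trivial_order_three:
  assumes "card (carrier G) = 3" "x \<in> carrier G" "x \<otimes> x = \<one>"
  shows "x = \<one>"
  using pow_order_eq_1[of x] assms by (simp add: order_def numeral_eq_Suc)

text \<open>
  If \<open>x \<notin> H\<close> and \<open>y \<notin> K\<close> but \<open>x \<in> K\<close> and \<open>y \<in> H\<close>, then \<open>x \<otimes> y\<close> avoids both subgroups.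
\<close>

lemma (in group) proper_subgroups_not_cover:
  assumes H: "subgroup H G" "H \<noteq> carrier G" and K: "subgroup K G" "K \<noteq> carrier G"
  obtains x where "x \<in> carrier G" "x \<notin> H" "x \<notin> K"
proof -
  obtain x where x: "x \<in> carrier G" "x \<notin> H" using H subgroup.subset by blast
  obtain y where y: "y \<in> carrier G" "y \<notin> K" using K subgroup.subset by blast
  show thesis
  proof (cases "x \<in> K \<and> y \<in> H")
    case True
    have "x \<otimes> y \<notin> H"
    proof
      assume "x \<otimes> y \<in> H"
      hence "x \<otimes> y \<otimes> inv y \<in> H" using True H(1) by (simp add: subgroup.m_closed subgroup.m_inv_closed)
      with x y show False by (simp add: m_assoc)
    qed
    moreover have "x \<otimes> y \<notin> K"
    proof
      assume "x \<otimes> y \<in> K"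
      hence "inv x \<otimes> (x \<otimes> y) \<in> K" using True K(1) by (simp add: subgroup.m_closed subgroup.m_inv_closed)
      with x y show False by (simp add: m_assoc[symmetric])
    qed
    ultimately show thesis using that[of "x \<otimes> y"] x y by simp
  qed (use that x y in blast)
qed

section \<open>Centralizers in a skew brace\<close>

sublocale skew_left_brace < add: group "add_monoid B"
  rewrites "carrier (add_monoid B) = carrier B"
    and "monoid.mult (add_monoid B) = ring.add B"
    and "monoid.one (add_monoid B) = \<zero>\<^bsub>B\<^esub>"
    and "m_inv (add_monoid B) = a_inv B"
  by (rule add_group) (auto simp: m_inv_def a_inv_def)

sublocale skew_left_brace < circ: group B
  by (rule circ_group)

definition brace_centralizer :: "('a, 'm) ring_scheme \<Rightarrow> 'a \<Rightarrow> 'a set" where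
  "brace_centralizer B a = {b \<in> carrier B.
     a \<oplus>\<^bsub>B\<^esub> b = b \<oplus>\<^bsub>B\<^esub> a \<and> b \<oplus>\<^bsub>B\<^esub> a = a \<otimes>\<^bsub>B\<^esub> b \<and> a \<otimes>\<^bsub>B\<^esub> b = b \<otimes>\<^bsub>B\<^esub> a}"

context skew_left_brace
begin

lemma zero_circ [simp]: "a \<in> carrier B \<Longrightarrow> \<zero> \<otimes> a = a"
  and circ_zero [simp]: "a \<in> carrier B \<Longrightarrow> a \<otimes> \<zero> = a"
  using circ.l_one circ.r_one by (simp_all add: one_eq_zero)

lemma add_cancel_mid: "\<lbrakk>x \<in> carrier B; y \<in> carrier B\<rbrakk> \<Longrightarrow> \<ominus> x \<oplus> (x \<oplus> y) = y"
  "\<lbrakk>x \<in> carrier B; y \<in> carrier B\<rbrakk> \<Longrightarrow> x \<oplus> (\<ominus> x \<oplus> y) = y"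
  by (simp_all add: add.m_assoc[symmetric])

lemma circ_add:
  assumes "a \<in> carrier B" "b \<in> carrier B" "c \<in> carrier B"
  shows "a \<otimes> (b \<oplus> c) = a \<otimes> b \<oplus> (\<ominus> a \<oplus> a \<otimes> c)"
  using brace_eq[OF assms] assms by (simp add: a_minus_def add.m_assoc)

lemma mem_brace_centralizer:
  "b \<in> brace_centralizer B a \<longleftrightarrow> b \<in> carrier B \<and> b \<oplus> a = a \<oplus> b \<and> a \<otimes> b = a \<oplus> b \<and> b \<otimes> a = a \<oplus> b"
  by (auto simp: brace_centralizer_def)

lemma brace_centralizer_sym:
  "\<lbrakk>a \<in> carrier B; b \<in> brace_centralizer B a\<rbrakk> \<Longrightarrow> a \<in> brace_centralizer B b"
  by (auto simp: mem_brace_centralizer)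

lemma zero_mem_brace_centralizer: "a \<in> carrier B \<Longrightarrow> \<zero> \<in> brace_centralizer B a"
  by (simp add: mem_brace_centralizer)

lemma brace_centralizer_zero: "brace_centralizer B \<zero> = carrier B"
  by (auto simp: mem_brace_centralizer)

lemma brace_centralizer_subset: "brace_centralizer B a \<subseteq> carrier B"
  by (auto simp: mem_brace_centralizer)

text \<open>
  Expanding \<open>a \<circ> (b \<circ> c) = b \<circ> (a \<circ> c)\<close> in the two ways offered by \<open>a \<circ> c = a + c = c + a\<close>
  yields both \<open>a + b \<circ> c\<close> and \<open>b \<circ> c + a\<close>. Inverses are treated in the same way, starting from
  \<open>a = b' \<circ> (a + b) = b' \<circ> (b + a)\<close> for the \<open>\<circ>\<close>-inverse \<open>b'\<close> of \<open>b\<close>.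
\<close>

lemma circ_subgroup_brace_centralizer:
  assumes a: "a \<in> carrier B"
  shows "subgroup (brace_centralizer B a) B"
proof
  show "brace_centralizer B a \<subseteq> carrier B" by (rule brace_centralizer_subset)
  show "\<one> \<in> brace_centralizer B a" using a by (simp add: one_eq_zero zero_mem_brace_centralizer)
next
  fix b c assume b: "b \<in> brace_centralizer B a" and c: "c \<in> brace_centralizer B a"
  note bc = b[unfolded mem_brace_centralizer] c[unfolded mem_brace_centralizer]
  have left: "a \<otimes> (b \<otimes> c) = a \<oplus> b \<otimes> c"
  proof -
    have "a \<otimes> (b \<otimes> c) = (b \<otimes> a) \<otimes> c"
      using a bc by (metis circ.m_assoc)
    also have "\<dots> = b \<otimes> (a \<otimes> c)" using a bc by (intro circ.m_assoc) auto
    also have "a \<otimes> c = a \<oplus> c" using bc by simp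
    also have "b \<otimes> (a \<oplus> c) = b \<otimes> a \<oplus> (\<ominus> b \<oplus> b \<otimes> c)" using a bc by (intro circ_add) auto
    also have "\<dots> = a \<oplus> b \<otimes> c" using a bc by (simp add: circ_add add.m_assoc add_cancel_mid)
    finally show ?thesis .
  qed
  have right: "(b \<otimes> c) \<otimes> a = b \<otimes> c \<oplus> a"
  proof -
    have "(b \<otimes> c) \<otimes> a = b \<otimes> (c \<oplus> a)" using a bc by (simp add: circ.m_assoc)
    also have "\<dots> = b \<otimes> c \<oplus> (\<ominus> b \<oplus> b \<otimes> a)" using a bc by (intro circ_add) auto
    also have "b \<otimes> a = b \<oplus> a" using bc by simp
    also have "\<ominus> b \<oplus> (b \<oplus> a) = a" using a bc by (intro add_cancel_mid) auto
    finally show ?thesis .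
  qed
  have "(b \<otimes> c) \<otimes> a = a \<otimes> (b \<otimes> c)"
    using a bc by (metis circ.m_assoc)
  thus "b \<otimes> c \<in> brace_centralizer B a"
    using a bc left right by (simp add: mem_brace_centralizer)
next
  fix b assume b: "b \<in> brace_centralizer B a"
  note b' = b[unfolded mem_brace_centralizer]
  let ?i = "inv b"
  have bB: "b \<in> carrier B" and i: "?i \<in> carrier B" using b' by auto
  have z: "?i \<otimes> b = \<zero>" using bB by (simp add: one_eq_zero)
  have absorb: "?i \<otimes> (b \<otimes> a) = a"
    using a bB z by (simp add: circ.m_assoc[symmetric])
  have 1: "a = ?i \<otimes> a \<oplus> \<ominus> ?i"
  proof -
    have "a = ?i \<otimes> (a \<oplus> b)" using absorb b' by simp
    thus ?thesis using a bB i z by (simp add: circ_add)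
  qed
  have 2: "a = \<ominus> ?i \<oplus> ?i \<otimes> a"
  proof -
    have "a = ?i \<otimes> (b \<oplus> a)" using absorb b' by simp
    thus ?thesis using a bB i z by (simp add: circ_add)
  qed
  have 3: "?i \<otimes> a = a \<oplus> ?i"
    using 1 a i by (metis add.inv_solve_right circ.m_closed)
  have 4: "?i \<otimes> a = ?i \<oplus> a"
    using 2 a i by (metis add.inv_solve_left circ.m_closed)
  have "b \<otimes> a = a \<otimes> b" using b' by simp
  hence "?i \<otimes> a = a \<otimes> ?i"
    using a bB i by (metis circ.inv_solve_left circ.inv_solve_right circ.m_assoc circ.m_closed)
  thus "?i \<in> brace_centralizer B a" using 3 4 i by (simp add: mem_brace_centralizer)
qed

text \<open>
  For commutative \<open>\<circ>\<close>, an element \<open>b\<close> belongs to \<open>C(a)\<close> as soon as it commutes additively with \<open>a\<close>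
  and satisfies \<open>a \<circ> b = a + b\<close>. The first condition describes an additive centralizer, the second
  the fixed points of the additive endomorphism \<open>b \<mapsto> - a + a \<circ> b\<close>.
\<close>

lemma add_subgroup_brace_centralizer:
  assumes a: "a \<in> carrier B"
    and comm: "\<And>x y. \<lbrakk>x \<in> carrier B; y \<in> carrier B\<rbrakk> \<Longrightarrow> x \<otimes> y = y \<otimes> x"
  shows "subgroup (brace_centralizer B a) (add_monoid B)"
proof (rule subgroup.intro, simp_all only: partial_object.simps monoid.simps)
  show "brace_centralizer B a \<subseteq> carrier B" by (rule brace_centralizer_subset)
  show "\<zero> \<in> brace_centralizer B a" using a by (rule zero_mem_brace_centralizer)
next
  fix b c assume b: "b \<in> brace_centralizer B a" and c: "c \<in> brace_centralizer B a"
  note bc = b[unfolded mem_brace_centralizer] c[unfolded mem_brace_centralizer]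
  have "a \<otimes> (b \<oplus> c) = a \<oplus> (b \<oplus> c)"
    using a bc by (simp add: circ_add add_cancel_mid add.m_assoc)
  moreover have "(b \<oplus> c) \<oplus> a = a \<oplus> (b \<oplus> c)"
    using a bc by (metis add.m_assoc)
  ultimately show "b \<oplus> c \<in> brace_centralizer B a"
    using a bc comm[of a "b \<oplus> c"] by (simp add: mem_brace_centralizer)
next
  fix b assume b: "b \<in> brace_centralizer B a"
  note b' = b[unfolded mem_brace_centralizer]
  have bB: "b \<in> carrier B" and nb: "\<ominus> b \<in> carrier B" using b' by auto
  have "a = b \<oplus> a \<otimes> (\<ominus> b)"
  proof -
    have "a = a \<otimes> (b \<oplus> \<ominus> b)" using a bB by simp
    also have "\<dots> = a \<otimes> b \<oplus> (\<ominus> a \<oplus> a \<otimes> (\<ominus> b))" by (rule circ_add[OF a bB nb])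
    also have "a \<otimes> b = b \<oplus> a" using b' by simp
    also have "b \<oplus> a \<oplus> (\<ominus> a \<oplus> a \<otimes> (\<ominus> b)) = b \<oplus> a \<otimes> (\<ominus> b)"
      using a bB nb by (simp add: add.m_assoc add_cancel_mid)
    finally show ?thesis .
  qed
  hence 1: "a \<otimes> (\<ominus> b) = \<ominus> b \<oplus> a"
    using a bB nb by (metis add.inv_solve_left circ.m_closed)
  have 2: "\<ominus> b \<oplus> a = a \<oplus> \<ominus> b"
    using a bB nb b' by (metis add.inv_solve_left add.inv_solve_right add.m_assoc add.m_closed)
  show "inv\<^bsub>add_monoid B\<^esub> b \<in> brace_centralizer B a"
    using 1 2 nb a comm[of a "\<ominus> b"] by (simp add: mem_brace_centralizer a_inv_def[symmetric])
qed


lemma minus_eq_zero_iff: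
  "\<lbrakk>x \<in> carrier B; y \<in> carrier B\<rbrakk> \<Longrightarrow> x \<ominus> y = \<zero> \<longleftrightarrow> x = y"
  unfolding a_minus_def by (metis add.inv_solve_right add.l_one add.one_closed)

lemma commuting_iff_mem_brace_centralizer:
  assumes a: "a \<in> carrier B" and b: "b \<in> carrier B"
  shows "brace_star B a b = \<zero> \<and> brace_star B b a = \<zero> \<and> add_commutator B a b = \<zero>
    \<longleftrightarrow> b \<in> brace_centralizer B a"
proof -
  have star: "brace_star B x y = \<zero> \<longleftrightarrow> x \<otimes> y = x \<oplus> y" if "x \<in> carrier B" "y \<in> carrier B" for x y
  proof -
    have "brace_star B x y = \<zero> \<longleftrightarrow> \<ominus> x \<oplus> x \<otimes> y = y"
      unfolding brace_star_def using that by (intro minus_eq_zero_iff) auto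
    thus ?thesis using that by (metis add.inv_solve_left circ.m_closed)
  qed
  have "add_commutator B a b = \<zero> \<longleftrightarrow> (a \<oplus> b) \<ominus> a = b"
    unfolding add_commutator_def using a b by (intro minus_eq_zero_iff) (auto simp: a_minus_def)
  also have "\<dots> \<longleftrightarrow> a \<oplus> b = b \<oplus> a"
    unfolding a_minus_def using a b by (metis add.inv_solve_right add.m_closed)
  finally have "add_commutator B a b = \<zero> \<longleftrightarrow> a \<oplus> b = b \<oplus> a" .
  thus ?thesis using a b star by (auto simp: mem_brace_centralizer)
qed

lemma commuting_probability_eq:
  assumes "finite (carrier B)"
  shows "commuting_probability B =
    real (\<Sum>a\<in>carrier B. card (brace_centralizer B a)) / real (card (carrier B)) ^ 2"
proof -
  have "{(a, b) \<in> carrier B \<times> carrier B.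
      brace_star B a b = \<zero> \<and> brace_star B b a = \<zero> \<and> add_commutator B a b = \<zero>}
    = Sigma (carrier B) (brace_centralizer B)"
    using commuting_iff_mem_brace_centralizer brace_centralizer_subset by blast
  moreover have "finite (brace_centralizer B a)" for a
    using assms brace_centralizer_subset by (rule finite_subset[rotated])
  ultimately show ?thesis
    unfolding commuting_probability_def using assms by simp
qed

lemma annihilator_iff:
  "a \<in> annihilator B \<longleftrightarrow> a \<in> carrier B \<and> brace_centralizer B a = carrier B"
  by (auto simp: annihilator_def brace_centralizer_def)

lemma card_brace_centralizer_dvd:
  assumes "a \<in> carrier B"
  shows "card (brace_centralizer B a) dvd card (carrier B)"
  using circ.lagrange[OF circ_subgroup_brace_centralizer[OF assms]] by (metis dvd_triv_right order_def)

section \<open>A nontrivial annihilator\<close>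

context
  assumes fin: "finite (carrier B)"
begin

lemma finite_brace_centralizer: "finite (brace_centralizer B a)"
  using fin brace_centralizer_subset by (rule finite_subset[rotated])

text \<open>
  Three elements leave five commuting pairs out of nine if only the pairs involving the identity
  commute, so counting alone does not settle this case. But both groups are cyclic of order three,
  so \<open>x + x\<close> and \<open>x \<circ> x\<close> are both the third element, and \<open>x\<close> commutes with itself.
\<close>

lemma annihilator_order_three:
  assumes three: "card (carrier B) = 3"
  shows "annihilator B \<noteq> {\<zero>}"
proof -
  have "card (carrier B - {\<zero>}) = 2" using three fin by (simp add: card_Diff_singleton)
  then obtain x y where xy: "carrier B - {\<zero>} = {x, y}" "x \<noteq> y"
    unfolding card_2_iff by blast
  hence x: "x \<in> carrier B" "x \<noteq> \<zero>" by auto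
  have B: "carrier B = {\<zero>, x, y}" using xy by auto
  have "x \<oplus> x \<noteq> \<zero>" "x \<oplus> x \<noteq> x" "x \<otimes> x \<noteq> \<zero>" "x \<otimes> x \<noteq> x"
    using add.involution_trivial_order_three[of x] circ.involution_trivial_order_three[of x] three x
    by (auto simp: one_eq_zero)
  moreover have "x \<oplus> x \<in> carrier B" "x \<otimes> x \<in> carrier B" using x by auto
  ultimately have "x \<otimes> x = x \<oplus> x" unfolding B by auto
  hence "{\<zero>, x} \<subseteq> brace_centralizer B x" using x by (auto simp: mem_brace_centralizer)
  from card_mono[OF finite_brace_centralizer this]
  have "card (brace_centralizer B x) \<ge> 2" using x by simp
  moreover have "card (brace_centralizer B x) \<le> 3"
    using card_mono[OF fin brace_centralizer_subset] three by simp
  moreover have "\<not> (2::nat) dvd 3" by simp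
  ultimately have "card (brace_centralizer B x) = 3"
    using card_brace_centralizer_dvd[OF x(1)] three by (cases "card (brace_centralizer B x) = 2") auto
  hence "brace_centralizer B x = carrier B"
    using three fin brace_centralizer_subset by (intro card_subset_eq) auto
  hence "x \<in> annihilator B" using x by (simp add: annihilator_iff)
  thus ?thesis using x by auto
qed

text \<open>
  By Lagrange, a centralizer other than \<open>B\<close> has index at least two, and if its index is not two
  then it is at least three.
\<close>

lemma proper_centralizer_at_most_half:
  assumes a: "a \<in> carrier B" "a \<notin> annihilator B"
  shows "2 * card (brace_centralizer B a) \<le> card (carrier B)"
    and "2 * card (brace_centralizer B a) \<noteq> card (carrier B) \<Longrightarrow>
      3 * card (brace_centralizer B a) \<le> card (carrier B)"
proof -
  have "brace_centralizer B a \<noteq> carrier B" using a by (simp add: annihilator_iff)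
  hence "brace_centralizer B a \<subset> carrier B" using brace_centralizer_subset[of a] by blast
  hence less: "card (brace_centralizer B a) < card (carrier B)" by (rule psubset_card_mono[OF fin])
  have nat_dvd: "2 * c \<le> n \<and> (2 * c \<noteq> n \<longrightarrow> 3 * c \<le> n)" if "c dvd n" "c < n" for c n :: nat
  proof -
    obtain k where k: "n = c * k" using \<open>c dvd n\<close> by (rule dvdE)
    have "k \<noteq> 0" "k \<noteq> 1" using \<open>c < n\<close> k by (intro notI; simp)+
    hence "k = 2 \<or> 3 \<le> k" by arith
    thus ?thesis
    proof
      assume "3 \<le> k"
      hence "c * 3 \<le> c * k" by (rule mult_le_mono2)
      thus ?thesis unfolding k by linarith
    qed (simp add: k)
  qed
  from nat_dvd[OF card_brace_centralizer_dvd[OF a(1)] less]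
  show "2 * card (brace_centralizer B a) \<le> card (carrier B)"
    and "2 * card (brace_centralizer B a) \<noteq> card (carrier B) \<Longrightarrow>
      3 * card (brace_centralizer B a) \<le> card (carrier B)"
    by blast+
qed

text \<open>
  The assumptions of this block are contradictory; everything up to
  \<open>trivial_annihilator_impossible\<close> works towards the contradiction.
\<close>

context
  fixes T
  assumes nontriv: "card (carrier B) > 1"
    and prob: "2 * (\<Sum>a\<in>carrier B. card (brace_centralizer B a)) > (card (carrier B))\<^sup>2"
    and ann: "annihilator B = {\<zero>}"
  defines T_def: "T \<equiv> {a \<in> carrier B. 2 * card (brace_centralizer B a) = card (carrier B)}"
begin

text \<open>
  Summation of a pointwise bound on \<open>|C(a)|\<close> over the nonzero elements; the scaling by \<open>k\<close> keeps
  bounds with denominators such as \<open>n/3\<close> within the natural numbers.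
\<close>

lemma centralizer_sum_less:
  assumes bound: "\<And>a. \<lbrakk>a \<in> carrier B; a \<noteq> \<zero>\<rbrakk> \<Longrightarrow>
    k * card (brace_centralizer B a) \<le> p + (if a \<in> T then q else 0)"
  shows "k * (card (carrier B))\<^sup>2 <
    2 * (k * card (carrier B) + (card (carrier B) - 1) * p + card T * q) \<or> k = 0"
proof -
  let ?n = "card (carrier B)"
  let ?S = "\<Sum>a\<in>carrier B. card (brace_centralizer B a)"
  have z: "\<zero> \<in> carrier B" by simp
  have "\<zero> \<notin> T" using nontriv by (simp add: T_def brace_centralizer_zero)
  hence T: "(carrier B - {\<zero>}) \<inter> T = T" by (auto simp: T_def)
  have "k * ?S = k * ?n + (\<Sum>a\<in>carrier B - {\<zero>}. k * card (brace_centralizer B a))"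
    by (simp add: sum.remove[OF fin z] brace_centralizer_zero distrib_left sum_distrib_left)
  also have "(\<Sum>a\<in>carrier B - {\<zero>}. k * card (brace_centralizer B a))
      \<le> (\<Sum>a\<in>carrier B - {\<zero>}. p + (if a \<in> T then q else 0))"
    using bound by (intro sum_mono) auto
  also have "\<dots> = (?n - 1) * p + card T * q"
    using fin z by (simp add: sum.distrib sum.If_cases card_Diff_singleton T)
  finally have le: "k * ?S \<le> k * ?n + ((?n - 1) * p + card T * q)" by simp
  show ?thesis
  proof (cases "k = 0")
    case False
    hence "k * ?n\<^sup>2 < k * (2 * ?S)" using prob by simp
    also have "\<dots> = 2 * (k * ?S)" by simp
    also have "\<dots> \<le> 2 * (k * ?n + ((?n - 1) * p + card T * q))" by (rule mult_le_mono2[OF le])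
    finally show ?thesis by (intro disjI1) (simp only: add.assoc)
  qed simp
qed

text \<open>
  With \<open>|C(a)| = n/2\<close> on \<open>T\<close> and \<open>|C(a)| \<le> n/3\<close> elsewhere, three nonzero elements outside \<open>T\<close>
  would bound the number of commuting pairs by \<open>n + (n - 4) n/2 + 3 n/3 = n\<^sup>2/2\<close>.
\<close>

lemma card_exceptions: "card (carrier B) < 4 + card T"
proof -
  let ?n = "card (carrier B)"
  \<comment> \<open>Six times the bound \<open>n/3\<close>, plus \<open>n\<close> to reach six times \<open>n/2\<close> on \<open>T\<close>.\<close>
  have "6 * ?n\<^sup>2 < 2 * (6 * ?n + (?n - 1) * (2 * ?n) + card T * ?n)"
  proof -
    have "6 * card (brace_centralizer B a) \<le> 2 * ?n + (if a \<in> T then ?n else 0)"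
      if "a \<in> carrier B" "a \<noteq> \<zero>" for a
      using proper_centralizer_at_most_half[of a] that ann by (simp add: T_def)
    from centralizer_sum_less[OF this] show ?thesis by simp
  qed
  moreover have "n < 4 + t"
    if n: "6 * n\<^sup>2 < 2 * (6 * n + (n - 1) * (2 * n) + t * n)" "n > 1" for n t :: nat
  proof -
    obtain d where d: "n = Suc d" using n(2) by (cases n) auto
    have "n * (6 * n) < n * (12 + 4 * d + 2 * t)"
      using n(1) by (simp add: d power2_eq_square algebra_simps)
    hence "6 * n < 12 + 4 * d + 2 * t" by (simp only: mult_less_cancel1)
    thus ?thesis using d by simp
  qed
  ultimately show ?thesis using nontriv by blast
qed

text \<open>
  If this failed, \<open>card_exceptions\<close> would force \<open>n \<le> 4\<close>. There integrality improves on the bound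
  \<open>n/3\<close>: for \<open>n = 2\<close> every nonzero element is in \<open>T\<close>, for \<open>n = 4\<close> a nonzero element outside \<open>T\<close> has
  \<open>|C(a)| = 1\<close>. The case \<open>n = 3\<close> is \<open>annihilator_order_three\<close>.
\<close>

lemma half_majority: "card (carrier B) < 2 * (card T + 1)"
proof (rule ccontr)
  let ?n = "card (carrier B)"
  assume neg: "\<not> ?thesis"
  have bound: "2 * card (brace_centralizer B a) \<le> ?n" if "a \<in> carrier B" "a \<noteq> \<zero>" for a
    using that proper_centralizer_at_most_half(1) ann by blast
  have "(n = 2 \<and> t = 0) \<or> n = 3 \<or> (n = 4 \<and> t = 1)"
    if "2 * (t + 1) \<le> n" "n < 4 + t" "n > 1" for n t :: nat
    using that by presburger
  from this[of "card T" ?n] neg card_exceptions nontriv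
  consider "?n = 2" "card T = 0" | "?n = 3" | "?n = 4" "card T = 1"
    by (metis not_less)
  thus False
  proof cases
    case 1
    have "1 * card (brace_centralizer B a) \<le> 0 + (if a \<in> T then 1 else 0)"
      if "a \<in> carrier B" "a \<noteq> \<zero>" for a
    proof -
      have "card (brace_centralizer B a) > 0"
        using zero_mem_brace_centralizer[OF that(1)] finite_brace_centralizer by (auto simp: card_gt_0_iff)
      hence "card (brace_centralizer B a) = 1" using bound[OF that] 1 by simp
      thus ?thesis using that 1 by (simp add: T_def)
    qed
    from centralizer_sum_less[OF this] 1 show False by simp
  next
    case 2
    thus False using annihilator_order_three ann by simp
  next
    case 3
    have "1 * card (brace_centralizer B a) \<le> 1 + (if a \<in> T then 1 else 0)"
      if "a \<in> carrier B" "a \<noteq> \<zero>" for a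
      using bound[OF that] 3 that by (auto simp: T_def)
    from centralizer_sum_less[OF this] 3 show False by simp
  qed
qed

text \<open>
  Such an \<open>s\<close> is centralized by \<open>T\<close> and zero, which is more than half of \<open>B\<close>, so \<open>C(s) = B\<close> and
  \<open>s\<close> lies in the trivial annihilator. All later vanishing statements come from this lemma.
\<close>

lemma zero_if_centralized_by_half:
  assumes s: "s \<in> carrier B" and T: "\<And>a. a \<in> T \<Longrightarrow> s \<in> brace_centralizer B a"
  shows "s = \<zero>"
proof (rule ccontr)
  assume "s \<noteq> \<zero>"
  hence half: "2 * card (brace_centralizer B s) \<le> card (carrier B)"
    using s ann proper_centralizer_at_most_half(1) by blast
  have "insert \<zero> T \<subseteq> brace_centralizer B s"
    using s T brace_centralizer_sym zero_mem_brace_centralizer by (auto simp: T_def)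
  from card_mono[OF finite_brace_centralizer this] have "card (insert \<zero> T) \<le> card (brace_centralizer B s)" .
  moreover have "card (insert \<zero> T) = card T + 1"
    using nontriv fin by (subst card_insert_disjoint) (auto simp: T_def brace_centralizer_zero)
  ultimately show False using half half_majority by simp
qed

text \<open>
  The subgroup \<open>C(a)\<close> has index two for \<open>a \<in> T\<close>, so it contains all squares.
\<close>

lemma circ_square_zero: "x \<in> carrier B \<Longrightarrow> x \<otimes> x = \<zero>"
  using circ.square_mem_index_two[OF fin circ_subgroup_brace_centralizer]
  by (intro zero_if_centralized_by_half) (auto simp: T_def)

lemma inv_self: "x \<in> carrier B \<Longrightarrow> inv x = x"
  using circ_square_zero[of x] by (intro circ.inv_equality) (auto simp: one_eq_zero)

lemma circ_comm: "\<lbrakk>x \<in> carrier B; y \<in> carrier B\<rbrakk> \<Longrightarrow> x \<otimes> y = y \<otimes> x"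
  using circ.inv_mult_group[of x y] by (simp add: inv_self)

lemma add_square_zero: "x \<in> carrier B \<Longrightarrow> x \<oplus> x = \<zero>"
  using add.square_mem_index_two[OF fin add_subgroup_brace_centralizer[OF _ circ_comm]]
  by (intro zero_if_centralized_by_half) (auto simp: T_def)

lemma minus_self: "x \<in> carrier B \<Longrightarrow> \<ominus> x = x"
  using add_square_zero[of x] by (intro add.inv_equality)

lemma add_comm: "\<lbrakk>x \<in> carrier B; y \<in> carrier B\<rbrakk> \<Longrightarrow> x \<oplus> y = y \<oplus> x"
  using add.inv_mult_group[of x y] by (simp add: minus_self)


lemma add_lcomm: "\<lbrakk>x \<in> carrier B; y \<in> carrier B; z \<in> carrier B\<rbrakk> \<Longrightarrow> x \<oplus> (y \<oplus> z) = y \<oplus> (x \<oplus> z)"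
  using add_comm[of x y] by (simp add: add.m_assoc[symmetric])

lemmas add_ac = add.m_assoc add_comm add_lcomm

lemma eq_if_add_zero: "\<lbrakk>x \<in> carrier B; y \<in> carrier B; x \<oplus> y = \<zero>\<rbrakk> \<Longrightarrow> x = y"
  using add.inv_equality[of x y] minus_self by simp

lemma T_carrier: "a \<in> T \<Longrightarrow> a \<in> carrier B"
  by (simp add: T_def)

text \<open>
  Here \<open>a + b + a \<circ> b\<close> measures the failure of \<open>a \<circ> b = a + b\<close>. Since \<open>C(a)\<close> has additive index
  two, \<open>b + c\<close> lies in it; expanding \<open>a \<circ> (b + c) = a + b + c\<close> shows that both deviations add up to
  zero, which means that they are equal.
\<close>

lemma deviation_const:
  assumes a: "a \<in> T"
    and b: "b \<in> carrier B" "b \<notin> brace_centralizer B a"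
    and c: "c \<in> carrier B" "c \<notin> brace_centralizer B a"
  shows "a \<oplus> b \<oplus> a \<otimes> b = a \<oplus> c \<oplus> a \<otimes> c"
proof (rule eq_if_add_zero)
  have aB: "a \<in> carrier B" using a by (rule T_carrier)
  have "b \<oplus> c \<in> brace_centralizer B a"
    using add.mult_mem_index_two[OF fin add_subgroup_brace_centralizer[OF aB circ_comm] _ b c] a
    by (simp add: T_def)
  hence "a \<oplus> (b \<oplus> c) = a \<otimes> (b \<oplus> c)" by (simp add: mem_brace_centralizer)
  also have "\<dots> = a \<otimes> b \<oplus> (a \<oplus> a \<otimes> c)" using circ_add[OF aB b(1) c(1)] aB by (simp add: minus_self)
  finally have eq: "a \<oplus> (b \<oplus> c) = a \<otimes> b \<oplus> (a \<oplus> a \<otimes> c)" .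
  have "(a \<oplus> b \<oplus> a \<otimes> b) \<oplus> (a \<oplus> c \<oplus> a \<otimes> c) = (a \<oplus> (b \<oplus> c)) \<oplus> (a \<otimes> b \<oplus> (a \<oplus> a \<otimes> c))"
    using aB b c by (simp add: add_ac)
  also have "\<dots> = \<zero>" unfolding eq using aB b c by (intro add_square_zero) simp
  finally show "(a \<oplus> b \<oplus> a \<otimes> b) \<oplus> (a \<oplus> c \<oplus> a \<otimes> c) = \<zero>" .
qed (use a b c in \<open>simp_all add: T_def\<close>)

lemma mem_brace_centralizer_if:
  assumes "a \<in> carrier B" "b \<in> carrier B" "a \<otimes> b = a \<oplus> b"
  shows "b \<in> brace_centralizer B a"
  using assms add_comm[of b a] circ_comm[of b a] by (simp add: mem_brace_centralizer)

lemma self_mem_brace_centralizer: "a \<in> carrier B \<Longrightarrow> a \<in> brace_centralizer B a"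
  by (simp add: mem_brace_centralizer circ_square_zero add_square_zero)

lemma centralizer_proper_T:
  assumes "a \<in> T"
  shows "brace_centralizer B a \<noteq> carrier B"
proof
  assume eq: "brace_centralizer B a = carrier B"
  have "2 * card (brace_centralizer B a) = card (carrier B)" using assms by (simp add: T_def)
  thus False unfolding eq using nontriv by simp
qed

text \<open>
  Some \<open>c\<close> avoids both centralizers because two proper subgroups do not cover \<open>B\<close>. As \<open>a\<close> and \<open>b\<close>
  lie in both centralizers, \<open>c\<close>, \<open>c \<circ> a\<close> and \<open>c \<circ> b\<close> are three such elements. At most two nonzero
  elements lie outside \<open>T\<close>, so one of the three belongs to \<open>T\<close>.
\<close>

lemma common_noncommuting_element:
  assumes a: "a \<in> T" and b: "b \<in> T" and ab: "a \<noteq> b" "b \<in> brace_centralizer B a"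
  obtains c where "c \<in> T" "c \<notin> brace_centralizer B a" "c \<notin> brace_centralizer B b"
proof -
  have aB: "a \<in> carrier B" and bB: "b \<in> carrier B" using a b by (auto intro: T_carrier)
  note sub = circ_subgroup_brace_centralizer
  let ?out = "\<lambda>c. c \<in> carrier B \<and> c \<notin> brace_centralizer B a \<and> c \<notin> brace_centralizer B b"
  obtain c where c: "?out c"
    using circ.proper_subgroups_not_cover[OF sub[OF aB] centralizer_proper_T[OF a] sub[OF bB] centralizer_proper_T[OF b]]
    by blast
  have ba: "a \<in> brace_centralizer B b" using aB ab(2) by (rule brace_centralizer_sym)
  have shift: "?out (c \<otimes> d)"
    if d: "d \<in> carrier B" "d \<in> brace_centralizer B a" "d \<in> brace_centralizer B b" for d
  proof -
    have "c \<otimes> d \<notin> brace_centralizer B x" if x: "x \<in> {a, b}" for x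
    proof
      assume "c \<otimes> d \<in> brace_centralizer B x"
      hence "(c \<otimes> d) \<otimes> d \<in> brace_centralizer B x"
        using subgroup.m_closed[OF sub[OF aB]] subgroup.m_closed[OF sub[OF bB]] x d by auto
      moreover have "(c \<otimes> d) \<otimes> d = c" using c d by (simp add: circ.m_assoc circ_square_zero)
      ultimately show False using c x by auto
    qed
    thus ?thesis using c d by simp
  qed
  let ?X = "{c, c \<otimes> a, c \<otimes> b}"
  have out: "?out x" if "x \<in> ?X" for x
    using that c shift[OF aB self_mem_brace_centralizer[OF aB] ba]
      shift[OF bB ab(2) self_mem_brace_centralizer[OF bB]] by blast
  have zT: "\<zero> \<notin> T" using centralizer_proper_T brace_centralizer_zero by blast
  have finT: "finite T" and TB: "T \<subseteq> carrier B" using fin by (simp_all add: T_def)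
  have zX: "\<zero> \<notin> ?X" using out zero_mem_brace_centralizer[OF aB] by blast
  have "a \<noteq> \<zero>" "b \<noteq> \<zero>" using zT a b by auto
  hence "c \<noteq> c \<otimes> a" "c \<noteq> c \<otimes> b" "c \<otimes> a \<noteq> c \<otimes> b"
    using c aB bB ab(1) by (simp_all add: one_eq_zero)
  hence "card ?X = 3" by simp
  have "\<exists>x\<in>?X. x \<in> T"
  proof (rule ccontr)
    assume "\<not> ?thesis"
    hence "card (insert \<zero> ?X \<union> T) = card (insert \<zero> ?X) + card T"
      using zT finT by (intro card_Un_disjoint) auto
    also have "card (insert \<zero> ?X) = 4" using zX \<open>card ?X = 3\<close> by (subst card_insert_disjoint) auto
    finally have "card (insert \<zero> ?X \<union> T) = 4 + card T" .
    moreover have "card (insert \<zero> ?X \<union> T) \<le> card (carrier B)"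
      using c aB bB TB by (intro card_mono[OF fin]) auto
    ultimately show False using card_exceptions by simp
  qed
  thus thesis using out that by blast
qed

text \<open>
  The deviation is symmetric in its two arguments, so it can be carried from \<open>a\<close> to \<open>b\<close> through any
  element of \<open>T\<close> that commutes with neither; if \<open>a\<close> and \<open>b\<close> do not commute, directly.
\<close>

lemma deviation_unique:
  assumes a: "a \<in> T" and c: "c \<in> carrier B" "c \<notin> brace_centralizer B a"
    and b: "b \<in> T" and d: "d \<in> carrier B" "d \<notin> brace_centralizer B b"
  shows "a \<oplus> c \<oplus> a \<otimes> c = b \<oplus> d \<oplus> b \<otimes> d"
proof -
  have aB: "a \<in> carrier B" and bB: "b \<in> carrier B" using a b by (auto intro: T_carrier)
  have sym: "x \<oplus> y \<oplus> x \<otimes> y = y \<oplus> x \<oplus> y \<otimes> x" if "x \<in> carrier B" "y \<in> carrier B" for x y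
    using that by (simp add: add_comm[of x y] circ_comm[of x y])
  consider "a = b" | "b \<notin> brace_centralizer B a" | "a \<noteq> b" "b \<in> brace_centralizer B a" by blast
  thus ?thesis
  proof cases
    case 1
    thus ?thesis using deviation_const[OF a c, of d] d by simp
  next
    case 2
    hence "a \<notin> brace_centralizer B b" using brace_centralizer_sym bB by blast
    thus ?thesis
      using deviation_const[OF a c bB 2] deviation_const[OF b d aB] sym[OF aB bB] by simp
  next
    case 3
    obtain e where e: "e \<in> T" "e \<notin> brace_centralizer B a" "e \<notin> brace_centralizer B b"
      using common_noncommuting_element[OF a b 3] by blast
    have eB: "e \<in> carrier B" using e(1) by (rule T_carrier)
    have ne: "a \<notin> brace_centralizer B e" "b \<notin> brace_centralizer B e"
      using e brace_centralizer_sym eB by blast+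
    have "a \<oplus> c \<oplus> a \<otimes> c = e \<oplus> a \<oplus> e \<otimes> a"
      using deviation_const[OF a c eB e(2)] sym[OF aB eB] by simp
    also have "\<dots> = e \<oplus> b \<oplus> e \<otimes> b" by (rule deviation_const[OF e(1) aB ne(1) bB ne(2)])
    also have "\<dots> = b \<oplus> d \<oplus> b \<otimes> d"
      using deviation_const[OF b d eB e(3)] sym[OF bB eB] by simp
    finally show ?thesis .
  qed
qed

text \<open>
  Let \<open>u\<close> be the common deviation. Applying \<open>x \<circ>\<close> to \<open>u = x + y + x \<circ> y\<close> and using
  \<open>x \<circ> (x \<circ> y) = y\<close> shows that \<open>u\<close> commutes with every \<open>x \<in> T\<close>, so \<open>u = 0\<close>. Hence
  \<open>a \<circ> b = a + b\<close> for a pair that was chosen not to commute.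
\<close>

lemma trivial_annihilator_impossible: False
proof -
  have "T \<noteq> {}"
  proof
    assume "T = {}"
    hence "card T = 0" by simp
    with half_majority nontriv show False by simp
  qed
  then obtain a where a: "a \<in> T" by blast
  have out: "\<exists>y. y \<in> carrier B \<and> y \<notin> brace_centralizer B x" if "x \<in> T" for x
    using centralizer_proper_T[OF that] brace_centralizer_subset by blast
  from out[OF a] obtain b where b: "b \<in> carrier B" "b \<notin> brace_centralizer B a" by blast
  have aB: "a \<in> carrier B" using a by (rule T_carrier)
  define u where "u = a \<oplus> b \<oplus> a \<otimes> b"
  have uB: "u \<in> carrier B" using aB b by (simp add: u_def)
  have "u = \<zero>"
  proof (rule zero_if_centralized_by_half[OF uB])
    fix x assume x: "x \<in> T"
    have xB: "x \<in> carrier B" using x by (rule T_carrier)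
    from out[OF x] obtain y where y: "y \<in> carrier B" "y \<notin> brace_centralizer B x" by blast
    have u: "u = (x \<oplus> y) \<oplus> x \<otimes> y" unfolding u_def by (rule deviation_unique[OF a b x y])
    have xxy: "x \<otimes> (x \<otimes> y) = y"
      using xB y by (simp add: circ.m_assoc[symmetric] circ_square_zero)
    have "x \<otimes> u = x \<otimes> (x \<oplus> y) \<oplus> (x \<oplus> x \<otimes> (x \<otimes> y))"
      unfolding u using xB y by (subst circ_add) (auto simp: minus_self)
    also have "x \<otimes> (x \<oplus> y) = x \<oplus> x \<otimes> y"
      using xB y by (subst circ_add) (auto simp: minus_self circ_square_zero)
    also have "(x \<oplus> x \<otimes> y) \<oplus> (x \<oplus> x \<otimes> (x \<otimes> y)) = x \<oplus> u"
      unfolding xxy u using xB y by (simp add: add_ac)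
    finally show "u \<in> brace_centralizer B x" by (rule mem_brace_centralizer_if[OF xB uB])
  qed
  hence "(a \<oplus> b) \<oplus> a \<otimes> b = \<zero>" by (simp only: u_def)
  hence "a \<otimes> b = a \<oplus> b"
    by (rule eq_if_add_zero[symmetric, rotated 2]) (use aB b(1) in simp_all)
  hence "b \<in> brace_centralizer B a" by (rule mem_brace_centralizer_if[OF aB b(1)])
  with b show False by simp
qed

end

theorem annihilator_nontrivial:
  assumes "card (carrier B) > 1"
    and "2 * (\<Sum>a\<in>carrier B. card (brace_centralizer B a)) > (card (carrier B))\<^sup>2"
  shows "annihilator B \<noteq> {\<zero>}"
  using trivial_annihilator_impossible[OF assms] by blast

end


end

section \<open>Ideals and quotients\<close>

text \<open>
  Preimages rather than images are needed, because each \<open>Ann\<^sub>n\<^sub>+\<^sub>1(B)\<close> is the preimage of an annihilator.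
\<close>

lemma (in group) normal_preimage:
  assumes H: "group H" and f: "f \<in> hom G H" and N: "N \<lhd> H"
  shows "{a \<in> carrier G. f a \<in> N} \<lhd> G"
proof -
  interpret H: group H by (rule H)
  interpret f: group_hom G H f by unfold_locales (rule f)
  note sub = H.normal_invE(1)[OF N] and conj = H.normal_invE(2)[OF N]
  show ?thesis
  proof (rule normal_invI)
    show "subgroup {a \<in> carrier G. f a \<in> N} G"
      by (rule subgroup.intro)
        (auto simp: subgroup.m_closed[OF sub] subgroup.m_inv_closed[OF sub] subgroup.one_closed[OF sub])
    fix x h assume "x \<in> carrier G" "h \<in> {a \<in> carrier G. f a \<in> N}"
    thus "x \<otimes> h \<otimes> inv x \<in> {a \<in> carrier G. f a \<in> N}"
      using conj[of "f x" "f h"] by simp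
  qed
qed

definition brace_epi :: "('a, 'm) ring_scheme \<Rightarrow> ('b, 'n) ring_scheme \<Rightarrow> ('a \<Rightarrow> 'b) \<Rightarrow> bool" where
  "brace_epi B Q f \<longleftrightarrow> f ` carrier B = carrier Q \<and> f \<zero>\<^bsub>B\<^esub> = \<zero>\<^bsub>Q\<^esub> \<and> f \<one>\<^bsub>B\<^esub> = \<one>\<^bsub>Q\<^esub> \<and>
     (\<forall>a\<in>carrier B. \<forall>b\<in>carrier B.
        f (a \<oplus>\<^bsub>B\<^esub> b) = f a \<oplus>\<^bsub>Q\<^esub> f b \<and> f (a \<otimes>\<^bsub>B\<^esub> b) = f a \<otimes>\<^bsub>Q\<^esub> f b)"

text \<open>
  The last condition is invariance under the additive endomorphisms \<open>b \<mapsto> - a + a \<circ> b\<close>; it is what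
  makes additive and multiplicative cosets agree.
\<close>

definition brace_ideal :: "('a, 'm) ring_scheme \<Rightarrow> 'a set \<Rightarrow> bool" where
  "brace_ideal B I \<longleftrightarrow> I \<lhd> add_monoid B \<and> I \<lhd> B \<and>
     (\<forall>a\<in>carrier B. \<forall>i\<in>I. \<ominus>\<^bsub>B\<^esub> a \<oplus>\<^bsub>B\<^esub> (a \<otimes>\<^bsub>B\<^esub> i) \<in> I)"

text \<open>
  The group laws of the codomain are read off from representatives, so that quotients by ideals are
  groups for both operations without any further coset calculus.
\<close>

lemma group_surj_image:
  fixes G (structure) and H (structure)
  assumes G: "group G" and surj: "f ` carrier G = carrier H"
    and one: "f \<one>\<^bsub>G\<^esub> = \<one>\<^bsub>H\<^esub>"
    and mult: "\<And>x y. \<lbrakk>x \<in> carrier G; y \<in> carrier G\<rbrakk> \<Longrightarrow> f (x \<otimes>\<^bsub>G\<^esub> y) = f x \<otimes>\<^bsub>H\<^esub> f y"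
  shows "group H"
proof -
  interpret G: group G by (rule G)
  have rep: "\<exists>a. a \<in> carrier G \<and> x = f a" if "x \<in> carrier H" for x using that surj by blast
  have cl: "f a \<in> carrier H" if "a \<in> carrier G" for a using that surj by blast
  show ?thesis
  proof (rule groupI)
    fix x y assume xy: "x \<in> carrier H" "y \<in> carrier H"
    obtain a where "a \<in> carrier G" "x = f a" using rep[OF xy(1)] by blast
    moreover obtain b where "b \<in> carrier G" "y = f b" using rep[OF xy(2)] by blast
    ultimately show "x \<otimes>\<^bsub>H\<^esub> y \<in> carrier H" using cl[of "a \<otimes>\<^bsub>G\<^esub> b"] by (simp add: mult)
  next
    show "\<one>\<^bsub>H\<^esub> \<in> carrier H" using cl[of "\<one>\<^bsub>G\<^esub>"] one by simp
  next
    fix x y z assume xyz: "x \<in> carrier H" "y \<in> carrier H" "z \<in> carrier H"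
    obtain a where a: "a \<in> carrier G" "x = f a" using rep[OF xyz(1)] by blast
    obtain b where b: "b \<in> carrier G" "y = f b" using rep[OF xyz(2)] by blast
    obtain c where c: "c \<in> carrier G" "z = f c" using rep[OF xyz(3)] by blast
    note abc = a b c
    have "f a \<otimes>\<^bsub>H\<^esub> f b \<otimes>\<^bsub>H\<^esub> f c = f (a \<otimes>\<^bsub>G\<^esub> b \<otimes>\<^bsub>G\<^esub> c)" using abc by (simp only: mult G.m_closed)
    also have "\<dots> = f (a \<otimes>\<^bsub>G\<^esub> (b \<otimes>\<^bsub>G\<^esub> c))" using abc by (simp only: G.m_assoc)
    also have "\<dots> = f a \<otimes>\<^bsub>H\<^esub> (f b \<otimes>\<^bsub>H\<^esub> f c)" using abc by (simp only: mult G.m_closed)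
    finally show "x \<otimes>\<^bsub>H\<^esub> y \<otimes>\<^bsub>H\<^esub> z = x \<otimes>\<^bsub>H\<^esub> (y \<otimes>\<^bsub>H\<^esub> z)" using abc by simp
  next
    fix x assume "x \<in> carrier H"
    then obtain a where a: "a \<in> carrier G" "x = f a" using rep by blast
    show "\<one>\<^bsub>H\<^esub> \<otimes>\<^bsub>H\<^esub> x = x" using a mult[of "\<one>\<^bsub>G\<^esub>" a, symmetric] one by simp
    have "f (inv\<^bsub>G\<^esub> a) \<otimes>\<^bsub>H\<^esub> x = \<one>\<^bsub>H\<^esub>" using a mult[of "inv\<^bsub>G\<^esub> a" a, symmetric] one by simp
    thus "\<exists>y\<in>carrier H. y \<otimes>\<^bsub>H\<^esub> x = \<one>\<^bsub>H\<^esub>" using cl[of "inv\<^bsub>G\<^esub> a"] a by blast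
  qed
qed

context skew_left_brace
begin

lemma
  assumes f: "brace_epi B Q f"
  shows brace_epi_add_hom: "f \<in> hom (add_monoid B) (add_monoid Q)"
    and brace_epi_circ_hom: "f \<in> hom B Q"
  using f by (auto simp: brace_epi_def hom_def)

lemma skew_left_brace_epi_image:
  assumes f: "brace_epi B Q f"
  shows "skew_left_brace Q"
proof -
  have add: "f (a \<oplus> b) = f a \<oplus>\<^bsub>Q\<^esub> f b" and circ: "f (a \<otimes> b) = f a \<otimes>\<^bsub>Q\<^esub> f b"
    if "a \<in> carrier B" "b \<in> carrier B" for a b using f that by (auto simp: brace_epi_def)
  have surj: "f ` carrier B = carrier Q" using f by (simp add: brace_epi_def)
  have addQ: "group (add_monoid Q)"
    by (rule group_surj_image[OF add_group, of f]) (use f in \<open>auto simp: brace_epi_def\<close>)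
  have circQ: "group Q"
    by (rule group_surj_image[OF circ_group, of f]) (use f in \<open>auto simp: brace_epi_def\<close>)
  interpret h: group_hom "add_monoid B" "add_monoid Q" f
    using add_group addQ brace_epi_add_hom[OF f] by (simp add: group_hom_def group_hom_axioms_def)
  have minus: "f (a \<ominus> b) = f a \<ominus>\<^bsub>Q\<^esub> f b" if "a \<in> carrier B" "b \<in> carrier B" for a b
    using that h.hom_inv[of b] by (simp add: a_minus_def a_inv_def[symmetric] add)
  show ?thesis
  proof (rule skew_left_brace.intro[OF addQ circQ])
    fix x y z assume xyz: "x \<in> carrier Q" "y \<in> carrier Q" "z \<in> carrier Q"
    obtain a where a: "a \<in> carrier B" "x = f a" using xyz(1) unfolding surj[symmetric] by blast
    obtain b where b: "b \<in> carrier B" "y = f b" using xyz(2) unfolding surj[symmetric] by blast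
    obtain c where c: "c \<in> carrier B" "z = f c" using xyz(3) unfolding surj[symmetric] by blast
    have "a \<otimes> b \<ominus> a \<in> carrier B" using a b by (simp add: a_minus_def)
    with a b c have "f (((a \<otimes> b) \<ominus> a) \<oplus> (a \<otimes> c)) = ((x \<otimes>\<^bsub>Q\<^esub> y) \<ominus>\<^bsub>Q\<^esub> x) \<oplus>\<^bsub>Q\<^esub> (x \<otimes>\<^bsub>Q\<^esub> z)"
      by (simp add: add circ minus)
    moreover have "f (a \<otimes> (b \<oplus> c)) = x \<otimes>\<^bsub>Q\<^esub> (y \<oplus>\<^bsub>Q\<^esub> z)"
      using a b c by (simp add: add circ)
    ultimately show "x \<otimes>\<^bsub>Q\<^esub> (y \<oplus>\<^bsub>Q\<^esub> z) = ((x \<otimes>\<^bsub>Q\<^esub> y) \<ominus>\<^bsub>Q\<^esub> x) \<oplus>\<^bsub>Q\<^esub> (x \<otimes>\<^bsub>Q\<^esub> z)"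
      using brace_eq[OF a(1) b(1) c(1)] by simp
  qed
qed

lemma brace_ideal_preimage:
  assumes f: "brace_epi B Q f" and J: "brace_ideal Q J"
  shows "brace_ideal B {a \<in> carrier B. f a \<in> J}"
proof -
  interpret Q: skew_left_brace Q by (rule skew_left_brace_epi_image[OF f])
  have add: "f (a \<oplus> b) = f a \<oplus>\<^bsub>Q\<^esub> f b" and circ: "f (a \<otimes> b) = f a \<otimes>\<^bsub>Q\<^esub> f b"
    if "a \<in> carrier B" "b \<in> carrier B" for a b using f that by (auto simp: brace_epi_def)
  have cl: "f a \<in> carrier Q" if "a \<in> carrier B" for a using f that by (auto simp: brace_epi_def)
  interpret h: group_hom "add_monoid B" "add_monoid Q" f
    using add_group Q.add_group brace_epi_add_hom[OF f] by (simp add: group_hom_def group_hom_axioms_def)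
  have minus: "f (\<ominus> a) = \<ominus>\<^bsub>Q\<^esub> f a" if "a \<in> carrier B" for a
    using that h.hom_inv[of a] by (simp add: a_inv_def[symmetric])
  have "{a \<in> carrier B. f a \<in> J} \<lhd> add_monoid B"
    using group.normal_preimage[OF add_group Q.add_group brace_epi_add_hom[OF f], of J] J
    by (simp add: brace_ideal_def)
  moreover have "{a \<in> carrier B. f a \<in> J} \<lhd> B"
    using circ.normal_preimage[OF Q.circ_group brace_epi_circ_hom[OF f], of J] J
    by (simp add: brace_ideal_def)
  ultimately show ?thesis
    using J cl by (auto simp: brace_ideal_def add circ minus)
qed

lemma
  assumes I: "brace_ideal B I"
  shows brace_ideal_add_subgroup: "subgroup I (add_monoid B)"
    and brace_ideal_circ_subgroup: "subgroup I B"
    and brace_ideal_subset: "I \<subseteq> carrier B"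
proof -
  show "subgroup I (add_monoid B)" using I group.normal_invE(1)[OF add_group] by (simp add: brace_ideal_def)
  show sub: "subgroup I B" using I circ.normal_invE(1) by (simp add: brace_ideal_def)
  show "I \<subseteq> carrier B" using sub by (rule subgroup.subset)
qed

text \<open>
  By normality the claim is \<open>a + I = a \<circ> I\<close>. Invariance of \<open>I\<close> under \<open>\<lambda>\<^sub>a(i) = - a + a \<circ> i\<close> gives
  \<open>a \<circ> i = a + \<lambda>\<^sub>a(i) \<in> a + I\<close>. Conversely \<open>a + i = a \<circ> \<lambda>\<^sub>b(i)\<close> for the \<open>\<circ>\<close>-inverse \<open>b\<close> of \<open>a\<close>,
  since \<open>\<lambda>\<^sub>b\<close> is inverse to \<open>\<lambda>\<^sub>a\<close>.
\<close>

lemma add_coset_eq_circ_coset: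
  assumes I: "brace_ideal B I" and a: "a \<in> carrier B"
  shows "I +> a = I #> a"
proof -
  have Isub: "I \<subseteq> carrier B" using I by (rule brace_ideal_subset)
  have "I +> a = (\<lambda>i. a \<oplus> i) ` I"
    using normal.coset_eq[of I "add_monoid B"] I a
    by (auto simp: brace_ideal_def a_r_coset_def l_coset_def)
  moreover have "I #> a = (\<lambda>i. a \<otimes> i) ` I"
    using normal.coset_eq[of I B] I a by (auto simp: brace_ideal_def l_coset_def)
  moreover have "(\<lambda>i. a \<otimes> i) ` I \<subseteq> (\<lambda>i. a \<oplus> i) ` I"
  proof (rule image_subsetI)
    fix i assume i: "i \<in> I"
    have "a \<otimes> i = a \<oplus> (\<ominus> a \<oplus> a \<otimes> i)" using a i Isub by (simp add: add_cancel_mid subsetD)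
    moreover have "\<ominus> a \<oplus> a \<otimes> i \<in> I" using I a i by (simp add: brace_ideal_def)
    ultimately show "a \<otimes> i \<in> (\<lambda>i. a \<oplus> i) ` I" by blast
  qed
  moreover have "(\<lambda>i. a \<oplus> i) ` I \<subseteq> (\<lambda>i. a \<otimes> i) ` I"
  proof (rule image_subsetI)
    fix i assume i: "i \<in> I"
    let ?b = "inv a"
    have iB: "i \<in> carrier B" using i Isub by blast
    have b: "?b \<in> carrier B" "\<ominus> ?b \<in> carrier B" using a by auto
    have ab: "a \<otimes> ?b = \<zero>" using a by (simp add: one_eq_zero)
    have mem: "\<ominus> ?b \<oplus> ?b \<otimes> i \<in> I" using I b i by (simp add: brace_ideal_def)
    have "a = a \<otimes> (?b \<oplus> \<ominus> ?b)" using a b by simp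
    also have "\<dots> = \<zero> \<oplus> (\<ominus> a \<oplus> a \<otimes> (\<ominus> ?b))" unfolding circ_add[OF a b] ab ..
    finally have "\<ominus> a \<oplus> a \<otimes> (\<ominus> ?b) = a" using a b by simp
    hence twice: "a \<otimes> (\<ominus> ?b) = a \<oplus> a" using a b add_cancel_mid(2)[of a "a \<otimes> (\<ominus> ?b)"] by simp
    have abi: "a \<otimes> (?b \<otimes> i) = i"
      using a b iB ab by (simp only: circ.m_assoc[symmetric] zero_circ)
    have "a \<otimes> (\<ominus> ?b \<oplus> ?b \<otimes> i) = (a \<oplus> a) \<oplus> (\<ominus> a \<oplus> i)"
      using circ_add[OF a b(2), of "?b \<otimes> i"] b iB by (simp add: twice abi)
    also have "\<dots> = a \<oplus> i" using a iB by (simp add: add.m_assoc add_cancel_mid)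
    finally show "a \<oplus> i \<in> (\<lambda>i. a \<otimes> i) ` I" using mem by (metis imageI)
  qed
  ultimately show ?thesis by blast
qed

lemma add_coset_sum:
  assumes I: "brace_ideal B I" and ab: "a \<in> carrier B" "b \<in> carrier B"
  shows "(I +> a) <+> (I +> b) = I +> (a \<oplus> b)"
  using normal.rcos_sum[of I "add_monoid B" a b] I ab
  by (simp add: set_add_def a_r_coset_def brace_ideal_def)

text \<open>
  All cosets in the union that defines the product coincide: the additive cosets are \<open>\<circ>\<close>-cosets of a
  normal subgroup, for which \<open>x \<circ> y\<close> represents the product of the cosets of \<open>x\<close> and \<open>y\<close>.
\<close>

lemma coset_circ:
  assumes I: "brace_ideal B I" and ab: "a \<in> carrier B" "b \<in> carrier B"
  shows "rcoset_mult B I (I +> a) (I +> b) = I +> (a \<otimes> b)"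
proof -
  note coset = add_coset_eq_circ_coset[OF I] and sub = brace_ideal_circ_subgroup[OF I]
  have Isub: "I \<subseteq> carrier B" using I by (rule brace_ideal_subset)
  have const: "I +> (x \<otimes> y) = I +> (a \<otimes> b)" if x: "x \<in> I +> a" and y: "y \<in> I +> b" for x y
  proof -
    have xy: "x \<in> I #> a" "y \<in> I #> b" using x y ab by (simp_all add: coset)
    have cl: "x \<in> carrier B" "y \<in> carrier B"
      using xy circ.r_coset_subset_G[OF Isub ab(1)] circ.r_coset_subset_G[OF Isub ab(2)] by auto
    have "x \<otimes> y \<in> (I #> a) <#> (I #> b)" using xy unfolding set_mult_def by blast
    also have "(I #> a) <#> (I #> b) = I #> (a \<otimes> b)"
      using I by (intro normal.rcos_sum ab) (simp add: brace_ideal_def)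
    finally have "I #> (a \<otimes> b) = I #> (x \<otimes> y)"
      by (rule circ.repr_independence[OF _ circ.m_closed[OF ab] sub])
    thus ?thesis using ab cl by (simp add: coset)
  qed
  have self: "c \<in> I +> c" if "c \<in> carrier B" for c
    unfolding coset[OF that] by (rule circ.rcos_self[OF that sub])
  have "rcoset_mult B I (I +> a) (I +> b) = (\<Union>x\<in>I +> a. \<Union>y\<in>I +> b. I +> (a \<otimes> b))"
    unfolding rcoset_mult_def by (intro SUP_cong refl const)
  also have "\<dots> = I +> (a \<otimes> b)" using self[OF ab(1)] self[OF ab(2)] by auto
  finally show ?thesis .
qed

lemma coset_zero: "brace_ideal B I \<Longrightarrow> I +> \<zero> = I"
  using group.coset_mult_one[OF add_group, of I] brace_ideal_subset[of I] by (simp add: a_r_coset_def)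

lemma carrier_quotient: "carrier (B Quot I) = (\<lambda>a. I +> a) ` carrier B"
  by (auto simp: FactRing_def A_RCOSETS_def RCOSETS_def a_r_coset_def)

lemma brace_epi_quotient:
  assumes I: "brace_ideal B I"
  shows "brace_epi B (B Quot I) (\<lambda>a. I +> a)"
  unfolding brace_epi_def carrier_quotient
  by (simp add: FactRing_def add_coset_sum[OF I] coset_circ[OF I] coset_zero[OF I])

section \<open>The annihilator series\<close>

lemma annihilator_subset: "annihilator B \<subseteq> carrier B"
  by (auto simp: annihilator_def)

lemma annihilator_mem_centralizer:
  "\<lbrakk>z \<in> annihilator B; b \<in> carrier B\<rbrakk> \<Longrightarrow> z \<in> brace_centralizer B b"
  using brace_centralizer_sym annihilator_iff by blast

lemma annihilator_eqs:
  assumes "z \<in> annihilator B" "b \<in> carrier B"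
  shows "z \<oplus> b = b \<oplus> z" "b \<otimes> z = b \<oplus> z" "z \<otimes> b = b \<oplus> z"
  using annihilator_mem_centralizer[OF assms] by (simp_all add: mem_brace_centralizer)

lemma annihilatorI:
  assumes z: "z \<in> carrier B" and mem: "\<And>b. b \<in> carrier B \<Longrightarrow> z \<in> brace_centralizer B b"
  shows "z \<in> annihilator B"
proof -
  have "carrier B \<subseteq> brace_centralizer B z" using brace_centralizer_sym mem by blast
  thus ?thesis using z brace_centralizer_subset[of z] by (simp add: annihilator_iff subset_antisym)
qed

text \<open>
  The annihilator is the intersection of all centralizers, hence a subgroup of \<open>(B,\<circ>)\<close>. On it, sums
  and negatives agree with products and \<open>\<circ>\<close>-inverses, which makes it an additive subgroup;
  normality and invariance hold because its elements are central for both operations and satisfy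
  \<open>- a + a \<circ> i = i\<close>.
\<close>

lemma brace_ideal_annihilator: "brace_ideal B (annihilator B)"
proof -
  have B: "z \<in> carrier B" if "z \<in> annihilator B" for z using that annihilator_subset by blast
  note sub = circ_subgroup_brace_centralizer
  have circ_sub: "subgroup (annihilator B) B"
  proof (rule subgroup.intro)
    show "annihilator B \<subseteq> carrier B" by (rule annihilator_subset)
    show "\<one> \<in> annihilator B"
      by (rule annihilatorI) (simp_all add: subgroup.one_closed[OF sub])
    show "x \<otimes> y \<in> annihilator B" if "x \<in> annihilator B" "y \<in> annihilator B" for x y
      using that by (intro annihilatorI) (simp_all add: B subgroup.m_closed[OF sub] annihilator_mem_centralizer)
    show "inv x \<in> annihilator B" if "x \<in> annihilator B" for x
      using that by (intro annihilatorI) (simp_all add: B subgroup.m_inv_closed[OF sub] annihilator_mem_centralizer)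
  qed
  have add_sub: "subgroup (annihilator B) (add_monoid B)"
  proof (rule subgroup.intro, simp_all only: partial_object.simps monoid.simps)
    show "annihilator B \<subseteq> carrier B" by (rule annihilator_subset)
    show "\<zero> \<in> annihilator B" using subgroup.one_closed[OF circ_sub] by (simp add: one_eq_zero)
    show "x \<oplus> y \<in> annihilator B" if "x \<in> annihilator B" "y \<in> annihilator B" for x y
      using subgroup.m_closed[OF circ_sub that] annihilator_eqs(2)[of y x] that B by simp
    show "inv\<^bsub>add_monoid B\<^esub> x \<in> annihilator B" if x: "x \<in> annihilator B" for x
    proof -
      have ix: "inv x \<in> annihilator B" using subgroup.m_inv_closed[OF circ_sub x] .
      have "inv x \<oplus> x = inv x \<otimes> x" using annihilator_eqs(2)[OF x B[OF ix]] by simp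
      also have "\<dots> = \<zero>" using B[OF x] by (simp add: one_eq_zero)
      finally have "\<ominus> x = inv x" using B[OF x] B[OF ix] by (rule add.inv_equality)
      thus ?thesis using ix by (simp add: a_inv_def)
    qed
  qed
  have "annihilator B \<lhd> add_monoid B"
  proof (rule group.normal_invI[OF add_group add_sub], simp only: partial_object.simps monoid.simps)
    fix x h assume x: "x \<in> carrier B" and h: "h \<in> annihilator B"
    have "x \<oplus> h \<oplus> \<ominus> x = h \<oplus> x \<oplus> \<ominus> x" by (simp only: annihilator_eqs(1)[OF h x])
    also have "\<dots> = h" using x B[OF h] by (simp add: add.m_assoc)
    finally show "x \<oplus> h \<oplus> inv\<^bsub>add_monoid B\<^esub> x \<in> annihilator B" using h by (simp add: a_inv_def)
  qed
  moreover have "annihilator B \<lhd> B"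
  proof (rule circ.normal_invI[OF circ_sub])
    fix x h assume x: "x \<in> carrier B" and h: "h \<in> annihilator B"
    have "x \<otimes> h \<otimes> inv x = h \<otimes> x \<otimes> inv x"
      by (simp only: annihilator_eqs(2)[OF h x] annihilator_eqs(3)[OF h x])
    also have "\<dots> = h" using x B[OF h] by (simp add: circ.m_assoc)
    finally show "x \<otimes> h \<otimes> inv x \<in> annihilator B" using h by simp
  qed
  moreover have "\<ominus> a \<oplus> a \<otimes> i = i" if "a \<in> carrier B" "i \<in> annihilator B" for a i
    using that by (simp add: annihilator_eqs(2) add_cancel_mid B)
  ultimately show ?thesis by (simp add: brace_ideal_def)
qed

lemma annihilator_series_Suc:
  assumes "n \<ge> 1"
  shows "annihilator_series B (Suc n) = {a \<in> carrier B.
    annihilator_series B n +> a \<in> annihilator (B Quot annihilator_series B n)}"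
  using assms by (cases n) simp_all

lemma brace_ideal_annihilator_series:
  assumes "n \<ge> 1"
  shows "brace_ideal B (annihilator_series B n)"
  using assms
proof (induction n rule: nat_induct_at_least)
  case base
  show ?case by (simp add: brace_ideal_annihilator)
next
  case (Suc n)
  note epi = brace_epi_quotient[OF Suc.IH]
  interpret Q: skew_left_brace "B Quot annihilator_series B n"
    by (rule skew_left_brace_epi_image[OF epi])
  show ?case
    unfolding annihilator_series_Suc[OF Suc.hyps]
    by (rule brace_ideal_preimage[OF epi Q.brace_ideal_annihilator])
qed

context
  fixes I
  assumes fin: "finite (carrier B)" and I: "brace_ideal B I"
begin

lemma card_quotient: "card (carrier B) = card I * card (carrier (B Quot I))"
  using group.lagrange[OF add_group brace_ideal_add_subgroup[OF I]]
  by (simp add: FactRing_def A_RCOSETS_def order_def mult.commute)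

lemma card_coset:
  assumes "Y \<in> carrier (B Quot I)"
  shows "card Y = card I"
  using group.card_rcosets_equal[OF add_group, of Y I] assms brace_ideal_subset[OF I]
  by (simp add: FactRing_def A_RCOSETS_def)

text \<open>
  A commuting pair of \<open>B\<close> lies in the product of two commuting cosets, and such a product has
  \<open>|I|\<^sup>2\<close> elements.
\<close>

lemma card_commuting_pairs_quotient:
  "(\<Sum>a\<in>carrier B. card (brace_centralizer B a)) \<le>
    (card I)\<^sup>2 * (\<Sum>Y\<in>carrier (B Quot I). card (brace_centralizer (B Quot I) Y))"
proof -
  let ?Q = "B Quot I"
  let ?P = "Sigma (carrier ?Q) (brace_centralizer ?Q)"
  note epi = brace_epi_quotient[OF I]
  interpret Q: skew_left_brace ?Q by (rule skew_left_brace_epi_image[OF epi])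
  have finQ: "finite (carrier ?Q)" using fin by (simp add: carrier_quotient)
  have finP: "finite ?P" using finQ Q.finite_brace_centralizer[OF finQ] by (intro finite_SigmaI)
  have self: "c \<in> I +> c" if "c \<in> carrier B" for c
    unfolding add_coset_eq_circ_coset[OF I that]
    by (rule circ.rcos_self[OF that brace_ideal_circ_subgroup[OF I]])
  have pair: "(a, b) \<in> (\<Union>p\<in>?P. fst p \<times> snd p)"
    if a: "a \<in> carrier B" and b: "b \<in> brace_centralizer B a" for a b
  proof -
    have bB: "b \<in> carrier B" using b brace_centralizer_subset by blast
    have hom: "I +> (x \<oplus> y) = (I +> x) \<oplus>\<^bsub>?Q\<^esub> (I +> y)" "I +> (x \<otimes> y) = (I +> x) \<otimes>\<^bsub>?Q\<^esub> (I +> y)"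
      if "x \<in> carrier B" "y \<in> carrier B" for x y using epi that by (auto simp: brace_epi_def)
    have "I +> b \<in> brace_centralizer ?Q (I +> a)"
      using a bB b by (simp add: Q.mem_brace_centralizer mem_brace_centralizer hom[symmetric] carrier_quotient)
    moreover have "I +> a \<in> carrier ?Q" using a by (simp add: carrier_quotient)
    ultimately have "(I +> a, I +> b) \<in> ?P" by simp
    thus ?thesis by (rule UN_I) (use self[OF a] self[OF bB] in simp)
  qed
  have "(\<Sum>a\<in>carrier B. card (brace_centralizer B a)) = card (Sigma (carrier B) (brace_centralizer B))"
    using fin finite_brace_centralizer[OF fin] by simp
  also have "\<dots> \<le> card (\<Union>p\<in>?P. fst p \<times> snd p)"
  proof (rule card_mono)
    have "Y \<subseteq> carrier B" if "Y \<in> carrier ?Q" for Y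
      using that circ.r_coset_subset_G[OF brace_ideal_subset[OF I]]
      by (auto simp: carrier_quotient add_coset_eq_circ_coset[OF I])
    hence finY: "finite Y" if "Y \<in> carrier ?Q" for Y using that fin finite_subset by blast
    have "finite (fst p \<times> snd p)" if "p \<in> ?P" for p
      using that finY subsetD[OF Q.brace_centralizer_subset] by (intro finite_cartesian_product) auto
    thus "finite (\<Union>p\<in>?P. fst p \<times> snd p)" by (rule finite_UN_I[OF finP])
    show "Sigma (carrier B) (brace_centralizer B) \<subseteq> (\<Union>p\<in>?P. fst p \<times> snd p)"
    proof
      fix p assume "p \<in> Sigma (carrier B) (brace_centralizer B)"
      thus "p \<in> (\<Union>p\<in>?P. fst p \<times> snd p)" using pair[of "fst p" "snd p"] by (cases p) simp
    qed
  qed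
  also have "\<dots> \<le> (\<Sum>p\<in>?P. card (fst p \<times> snd p))" by (rule card_UN_le[OF finP])
  also have "\<dots> = (\<Sum>p\<in>?P. (card I)\<^sup>2)"
  proof (rule sum.cong[OF refl])
    fix p assume p: "p \<in> ?P"
    have "snd p \<in> carrier ?Q" using p subsetD[OF Q.brace_centralizer_subset] by auto
    thus "card (fst p \<times> snd p) = (card I)\<^sup>2"
      using p by (auto simp: card_cartesian_product card_coset power2_eq_square)
  qed
  also have "\<dots> = (card I)\<^sup>2 * (\<Sum>Y\<in>carrier ?Q. card (brace_centralizer ?Q Y))"
    using finQ Q.finite_brace_centralizer[OF finQ] by simp
  finally show ?thesis .
qed

end

text \<open>
  The quotient by \<open>Ann\<^sub>n(B)\<close> has more than one element and still more than half of its pairs commute.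
  A nonzero element of its annihilator is the coset of an element of \<open>Ann\<^sub>n\<^sub>+\<^sub>1(B)\<close> outside \<open>Ann\<^sub>n(B)\<close>.
\<close>

lemma annihilator_series_grows:
  assumes fin: "finite (carrier B)" and n: "n \<ge> 1"
    and prob: "2 * (\<Sum>a\<in>carrier B. card (brace_centralizer B a)) > (card (carrier B))\<^sup>2"
    and proper: "annihilator_series B n \<noteq> carrier B"
  shows "annihilator_series B n \<subset> annihilator_series B (Suc n)"
proof -
  let ?I = "annihilator_series B n" and ?Q = "B Quot annihilator_series B n"
  have I: "brace_ideal B ?I" by (rule brace_ideal_annihilator_series[OF n])
  note epi = brace_epi_quotient[OF I]
  interpret Q: skew_left_brace ?Q by (rule skew_left_brace_epi_image[OF epi])
  have Isub: "?I \<subseteq> carrier B" using I by (rule brace_ideal_subset)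
  have finQ: "finite (carrier ?Q)" using fin by (simp add: carrier_quotient)
  have card: "card (carrier B) = card ?I * card (carrier ?Q)" by (rule card_quotient[OF fin I])
  have zeroQ: "\<zero>\<^bsub>?Q\<^esub> = ?I" by (simp add: FactRing_def)
  have "card ?I < card (carrier B)" using Isub proper fin by (intro psubset_card_mono) auto
  moreover have "q > 1" if "i < i * q" for i q :: nat
    using that by (cases q rule: nat.exhaust) (auto simp: neq0_conv[symmetric] simp del: neq0_conv)
  ultimately have large: "card (carrier ?Q) > 1" unfolding card by blast
  have "(card ?I)\<^sup>2 * (card (carrier ?Q))\<^sup>2 = (card (carrier B))\<^sup>2"
    by (simp only: card power_mult_distrib)
  also have "\<dots> < 2 * (\<Sum>a\<in>carrier B. card (brace_centralizer B a))" by (rule prob)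
  also have "\<dots> \<le> 2 * ((card ?I)\<^sup>2 * (\<Sum>Y\<in>carrier ?Q. card (brace_centralizer ?Q Y)))"
    by (rule mult_le_mono2[OF card_commuting_pairs_quotient[OF fin I]])
  also have "\<dots> = (card ?I)\<^sup>2 * (2 * (\<Sum>Y\<in>carrier ?Q. card (brace_centralizer ?Q Y)))"
    by (rule mult.left_commute)
  finally have "2 * (\<Sum>Y\<in>carrier ?Q. card (brace_centralizer ?Q Y)) > (card (carrier ?Q))\<^sup>2"
    by (simp only: mult_less_cancel1)
  from Q.annihilator_nontrivial[OF finQ large this] have "annihilator ?Q \<noteq> {?I}"
    unfolding zeroQ .
  moreover have zero_ann: "?I \<in> annihilator ?Q"
    using subgroup.one_closed[OF Q.brace_ideal_circ_subgroup[OF Q.brace_ideal_annihilator]]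
    by (simp only: Q.one_eq_zero zeroQ)
  ultimately obtain Y where Y: "Y \<in> annihilator ?Q" "Y \<noteq> ?I" by blast
  have "Y \<in> carrier ?Q" using Y(1) Q.annihilator_subset by blast
  then obtain a where a: "a \<in> carrier B" "Y = ?I +> a" by (auto simp: carrier_quotient)
  have coset: "?I +> i = ?I" if "i \<in> ?I" for i
    using that Isub group.coset_join2[OF add_group _ brace_ideal_add_subgroup[OF I], of i]
    by (auto simp: a_r_coset_def)
  have "a \<in> annihilator_series B (Suc n)" using Y a by (simp add: annihilator_series_Suc[OF n])
  moreover have "a \<notin> ?I" using Y a coset by blast
  moreover have "?I \<subseteq> annihilator_series B (Suc n)"
    using Isub zero_ann coset by (auto simp: annihilator_series_Suc[OF n])
  ultimately show ?thesis by blast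
qed

text \<open>
  A strictly increasing chain of subsets of \<open>B\<close> would contain sets with more than \<open>|B|\<close> elements.
\<close>

theorem nilpotent_if_half_commutes:
  assumes fin: "finite (carrier B)"
    and prob: "2 * (\<Sum>a\<in>carrier B. card (brace_centralizer B a)) > (card (carrier B))\<^sup>2"
  shows "nilpotent_brace B"
proof (rule ccontr)
  assume "\<not> nilpotent_brace B"
  hence proper: "annihilator_series B n \<noteq> carrier B" if "n \<ge> 1" for n
    using that by (auto simp: nilpotent_brace_def)
  have sub: "annihilator_series B n \<subseteq> carrier B" if "n \<ge> 1" for n
    by (rule brace_ideal_subset[OF brace_ideal_annihilator_series[OF that]])
  have "n \<le> card (annihilator_series B (Suc n))" for n
  proof (induction n)
    case (Suc n)
    have "finite (annihilator_series B (Suc (Suc n)))" using sub fin by (rule finite_subset) simp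
    from psubset_card_mono[OF this annihilator_series_grows[OF fin _ prob proper]] Suc
    show ?case by simp
  qed simp
  from this[of "Suc (card (carrier B))"]
  have "card (carrier B) < card (annihilator_series B (Suc (Suc (card (carrier B)))))" by simp
  moreover have "card (annihilator_series B (Suc (Suc (card (carrier B))))) \<le> card (carrier B)"
    by (rule card_mono[OF fin sub]) simp
  ultimately show False by simp
qed

end

theorem theorem4p5:
  fixes B :: "'a ring"
  assumes "skew_left_brace B"
    and "finite (carrier B)"
    and "commuting_probability B > 65 / 128"
  shows "nilpotent_brace B"
proof -
  interpret skew_left_brace B by (rule assms(1))
  let ?n = "real (card (carrier B))" and ?S = "\<Sum>a\<in>carrier B. card (brace_centralizer B a)"
  have "carrier B \<noteq> {}" using add.one_closed by blast
  hence n: "?n ^ 2 > 0" using assms(2) by (simp add: card_gt_0_iff)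
  have "real ?S / ?n ^ 2 > 1 / 2"
    using assms(3) unfolding commuting_probability_eq[OF assms(2)] by linarith
  hence "?n ^ 2 < 2 * real ?S" using n by (simp add: field_simps)
  hence "real ((card (carrier B))\<^sup>2) < real (2 * ?S)" by simp
  hence "(card (carrier B))\<^sup>2 < 2 * ?S" by (simp only: of_nat_less_iff)
  thus ?thesis by (rule nilpotent_if_half_commutes[OF assms(2)])
qed

end
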